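(* Let $q,r,\mu,\nu$ be positive integers with $\nu\le q$. Then the kernel of $\mathcal{N}(z)$ is spanned by the columns of $\mathcal{K}^{\mu-1}(z)$ and has dimension $\nu(r-\mu)^+$. Hence the rank of $\mathcal{N}(z)$ equals $\nu\min\{\mu,r\}$, and $\mathcal{N}(z)$ has full rank iff $\mu\ge r$.
   Context: Matrix indices start at $0$. $u(z)=(1,\dots,z^{q-1})^\top$, $w(z)=(1,\dots,z^{r-1})$, $M(z)=u(z)w(z)$; $\mathcal{N}(z)\in\mathbb{C}^{\mu q\times\nu r}$ is the block matrix with $(i,j)$ block $\frac{1}{i!j!}M^{(i+j)}(z)$, $i<\mu$, $j<\nu$. For $0\le k\le r-2$, $F_k(z)\in\mathbb{C}^{(r-k)\times(r-k-1)}$ has entries $(F_k)_{ii}=-z$, $(F_k)_{i+1,i}=1$, zero otherwise, and $K_k(z)=I_\nu\otimes F_k(z)+S_\nu\otimes F_k'(z)\in\mathbb{C}^{\nu(r-k)\times\nu(r-k-1)}$, where $S_\nu$ is the $\nu\times\nu$ shift matrix $(S_\nu)_{ij}=\delta_{i+1,j}$ and $'$ is the $z$-derivative. For $\mu<r$, $\mathcal{K}^{\mu-1}(z)=K_0(z)K_1(z)\cdots K_{\mu-1}(z)\in\mathbb{C}^{\nu r\times\nu(r-\mu)}$; for $\mu\ge r$, $\mathcal{K}^{\mu-1}(z)$ is the zero matrix (so the kernel is $\{0\}$).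
   Formalization: "Full rank" is taken to mean full column rank (rank equal to νr); with the meaning rank = min(μq, νr) the final equivalence fails when ν = q and μ < r, e.g. q = ν = μ = 1, r = 2, where N(z) = (1, z). *)

theory Defs
  imports "HOL-Analysis.Analysis" "Jordan_Normal_Form.Matrix_Kernel" "Jordan_Normal_Form.DL_Rank"
begin

definition mat_deriv_n :: "nat \<Rightarrow> (complex \<Rightarrow> complex mat) \<Rightarrow> complex \<Rightarrow> complex mat" where
  "mat_deriv_n k A z = mat (dim_row (A z)) (dim_col (A z))
     (\<lambda>(i,j). (deriv ^^ k) (\<lambda>w. A w $$ (i,j)) z)"

definition kron :: "'a::times mat \<Rightarrow> 'a mat \<Rightarrow> 'a mat" where
  "kron A B = mat (dim_row A * dim_row B) (dim_col A * dim_col B)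
     (\<lambda>(I,J). A $$ (I div dim_row B, J div dim_col B) * B $$ (I mod dim_row B, J mod dim_col B))"

definition shift_mat :: "nat \<Rightarrow> complex mat" where
  "shift_mat n = mat n n (\<lambda>(i,j). if i + 1 = j then 1 else 0)"

definition u_vec :: "nat \<Rightarrow> complex \<Rightarrow> complex mat" where
  "u_vec q z = mat q 1 (\<lambda>(a,_). z ^ a)"

definition w_vec :: "nat \<Rightarrow> complex \<Rightarrow> complex mat" where
  "w_vec r z = mat 1 r (\<lambda>(_,b). z ^ b)"

text \<open>The block matrix N(z) in C^{(mu q) x (nu r)}: block (i,j) is M^{(i+j)}(z)/(i! j!);
  row index i*q+a, column index j*r+b.\<close>
definition Nmat :: "nat \<Rightarrow> nat \<Rightarrow> nat \<Rightarrow> nat \<Rightarrow> complex \<Rightarrow> complex mat" where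
  "Nmat q r \<mu> \<nu> z = mat (\<mu> * q) (\<nu> * r)
     (\<lambda>(I,J). (1 / (fact (I div q) * fact (J div r))) *
        mat_deriv_n (I div q + J div r) (\<lambda>w. u_vec q w * w_vec r w) z $$ (I mod q, J mod r))"

definition Fmat :: "nat \<Rightarrow> nat \<Rightarrow> complex \<Rightarrow> complex mat" where
  "Fmat r k z = mat (r - k) (r - k - 1)
     (\<lambda>(i,j). if i = j then - z else if i = j + 1 then 1 else 0)"

definition Kmat :: "nat \<Rightarrow> nat \<Rightarrow> nat \<Rightarrow> complex \<Rightarrow> complex mat" where
  "Kmat r \<nu> k z = kron (1\<^sub>m \<nu>) (Fmat r k z) + kron (shift_mat \<nu>) (mat_deriv_n 1 (Fmat r k) z)"

definition Kcal :: "nat \<Rightarrow> nat \<Rightarrow> nat \<Rightarrow> complex \<Rightarrow> complex mat" where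
  "Kcal r \<mu> \<nu> z = (if \<mu> < r
     then foldr (\<lambda>k acc. Kmat r \<nu> k z * acc) [0..<\<mu>] (1\<^sub>m (\<nu> * (r - \<mu>)))
     else 0\<^sub>m (\<nu> * r) (\<nu> * (r - \<mu>)))"

abbreviation span_vecs :: "nat \<Rightarrow> complex vec set \<Rightarrow> complex vec set" where
  "span_vecs n S \<equiv> LinearCombinations.module.span class_ring (module_vec TYPE(complex) n) S"

end

theory Submission
  imports Defs
begin

text \<open>Read a vector of length \<open>\<nu> r\<close> as polynomials \<open>W 0, ..., W (\<nu> - 1)\<close> of degree below
  \<open>r\<close>, and replace the rows of a block row of \<open>N(z)\<close> by all polynomials \<open>p\<close> of degree below \<open>q\<close>. Block
  row \<open>i\<close> then becomes the form \<open>L i p W\<close>, the sum over \<open>j\<close> of \<open>binomial (i + j) i\<close> times the Taylor coefficient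
  of order \<open>i + j\<close> of \<open>p W j\<close> at \<open>z\<close>, and every \<open>K_k(z)\<close> becomes the same operator
  \<open>(D W) j = (x - z) W j - W (j + 1)\<close>. Pascal's rule gives \<open>L (i + 1) p (D W) = L i p W\<close>, and a telescoping
  sum gives \<open>L 0 p (D W) = 0\<close>. The operator \<open>D\<close> is injective and, as \<open>\<nu> \<le> q\<close>, its range is the common
  kernel of all \<open>L 0 p\<close>. By induction on \<open>\<mu>\<close>, the kernel of the first \<open>\<mu>\<close> block rows is the range of the
  \<open>\<mu>\<close>-th power of \<open>D\<close>; the dimensions follow by rank-nullity.\<close>

unbundle no vec_syntax

section \<open>Column span, rank and nullity\<close>

lemma mult_mat_vec_linear:
  fixes A :: "'a :: field mat"
  assumes A: "A \<in> carrier_mat n m"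
  shows "linear_map class_ring (module_vec TYPE('a) m) (module_vec TYPE('a) n) (\<lambda>v. A *\<^sub>v v)"
proof -
  interpret V: vec_space "TYPE('a)" m .
  interpret W: vec_space "TYPE('a)" n .
  show ?thesis
    by unfold_locales
      (use A in \<open>auto simp: module_hom_def mult_add_distrib_mat_vec[OF A] mult_mat_vec[OF A]\<close>)
qed

lemma span_cols_eq_image:
  fixes A :: "complex mat"
  assumes A: "A \<in> carrier_mat n m"
  shows "span_vecs n (set (cols A)) = (\<lambda>v. A *\<^sub>v v) ` carrier_vec m"
  using vec_space.col_space_eq[OF A] A unfolding vec_space.col_space_def by auto

lemma rank_plus_kernel_dim:
  fixes A :: "'a :: field mat"
  assumes A: "A \<in> carrier_mat n m"
  shows "vec_space.rank n A + kernel_dim A = m"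
proof -
  interpret V: vec_space "TYPE('a)" m .
  interpret W: vec_space "TYPE('a)" n .
  interpret T: linear_map class_ring "module_vec TYPE('a) m" "module_vec TYPE('a) n" "\<lambda>v. A *\<^sub>v v"
    by (rule mult_mat_vec_linear[OF A])
  have im: "T.im = W.span (set (cols A))"
    using W.col_space_eq[OF A] A unfolding W.col_space_def T.im_def by auto
  have ker: "T.ker = mat_kernel A"
    unfolding T.ker_def using A by (auto simp: mat_kernel_def)
  show ?thesis
    using T.rank_nullity[OF V.fin_dim] A unfolding im ker W.rank_def kernel_dim_def V.dim_is_n
    by simp
qed

lemma rank_eq_dim_col:
  fixes A :: "'a :: field mat"
  assumes A: "A \<in> carrier_mat n m" and "mat_kernel A = {0\<^sub>v m}"
  shows "vec_space.rank n A = m"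
proof -
  \<comment> \<open>The identity has the same trivial kernel, and its nullity is known to be
    0.\<close>
  have "mat_kernel (1\<^sub>m m :: 'a mat) = {0\<^sub>v m}"
    by (auto simp: mat_kernel_def)
  then have "kernel_dim A = 0"
    using kernel_one_mat(1)[of m, where 'a = 'a] assms unfolding kernel_dim_def by simp
  then show ?thesis using rank_plus_kernel_dim[OF A] by simp
qed

text \<open>Both numbers are dimensions of the same subspace; this turns the nullity of N(z) into
  the rank of the kernel matrix.\<close>

lemma kernel_dim_eq_rank:
  fixes A K :: "complex mat"
  assumes A: "A \<in> carrier_mat n m" and "mat_kernel A = span_vecs m (set (cols K))"
  shows "kernel_dim A = vec_space.rank m K"
  using assms unfolding kernel_dim_def vec_space.rank_def by simp

section \<open>Taylor coefficients and the operator D\<close>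

text \<open>Translating by \<open>z\<close> first keeps the notion algebraic: a factor x - z becomes
  x, which merely shifts coefficients.\<close>

definition taylor_coeff :: "complex \<Rightarrow> nat \<Rightarrow> complex poly \<Rightarrow> complex" where
  "taylor_coeff z n p = coeff (p \<circ>\<^sub>p [:z, 1:]) n"

lemma taylor_coeff_linear:
  "taylor_coeff z n 0 = 0"
  "taylor_coeff z n (p + q) = taylor_coeff z n p + taylor_coeff z n q"
  "taylor_coeff z n (p - q) = taylor_coeff z n p - taylor_coeff z n q"
  "taylor_coeff z n (Polynomial.smult c p) = c * taylor_coeff z n p"
  by (simp_all add: taylor_coeff_def pcompose_add pcompose_diff pcompose_smult)

lemma taylor_coeff_sum: "taylor_coeff z n (\<Sum>x\<in>S. f x) = (\<Sum>x\<in>S. taylor_coeff z n (f x))"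
  by (simp add: taylor_coeff_def pcompose_sum coeff_sum)

lemma taylor_coeff_0: "taylor_coeff z 0 p = poly p z"
  by (simp add: taylor_coeff_def flip: poly_0_coeff_0) (simp add: poly_pcompose)

lemma pcompose_shift_linear: "[:- z, 1 :: complex:] \<circ>\<^sub>p [:z, 1:] = [:0, 1:]"
  by (simp add: pcompose_pCons)

lemma pcompose_shift_power: "([:- z, 1 :: complex:] ^ k) \<circ>\<^sub>p [:z, 1:] = monom 1 k"
  by (induction k)
    (simp_all only: power_0 power_Suc pcompose_mult pcompose_shift_linear,
     simp_all add: monom_altdef pcompose_1)

lemma taylor_coeff_shift:
  "taylor_coeff z n ([:- z, 1:] * p) = (case n of 0 \<Rightarrow> 0 | Suc m \<Rightarrow> taylor_coeff z m p)"
  by (simp only: taylor_coeff_def pcompose_mult pcompose_shift_linear)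
     (simp split: nat.split)

lemma taylor_coeff_shift_power:
  "taylor_coeff z n ([:- z, 1:] ^ k * p) = (if n < k then 0 else taylor_coeff z (n - k) p)"
  by (simp add: taylor_coeff_def pcompose_mult pcompose_shift_power coeff_monom_mult)

lemma higher_deriv_poly: "(deriv ^^ n) (poly p) = poly ((pderiv ^^ n) (p :: complex poly))"
proof (induction n)
  case (Suc n)
  have "deriv (poly q) = poly (pderiv q)" for q :: "complex poly"
    by (rule ext) (simp add: DERIV_imp_deriv poly_DERIV)
  then show ?case using Suc by simp
qed simp

lemma higher_pderiv_pcompose_shift:
  "(pderiv ^^ n) (p \<circ>\<^sub>p [:z, 1 :: complex:]) = ((pderiv ^^ n) p) \<circ>\<^sub>p [:z, 1:]"
  by (induction n) (simp_all add: pderiv_pcompose pderiv_pCons)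

text \<open>Differentiation commutes with translation by \<open>z\<close>, so the derivative at
  \<open>z\<close> is the constant coefficient of the \<open>n\<close>-th derivative of the
  translated polynomial.\<close>

lemma higher_deriv_poly_eq_taylor_coeff:
  "(deriv ^^ n) (poly p) z = fact n * taylor_coeff z n p"
proof -
  have "poly ((pderiv ^^ n) p) z = taylor_coeff z 0 ((pderiv ^^ n) p)"
    by (simp add: taylor_coeff_0)
  also have "\<dots> = fact n * taylor_coeff z n p"
    by (simp add: taylor_coeff_def flip: higher_pderiv_pcompose_shift)
       (simp add: coeff_higher_pderiv pochhammer_fact)
  finally show ?thesis by (simp add: higher_deriv_poly)
qed

section \<open>Polynomial sequences, the row forms and the operator D\<close>

text \<open>Bounding the degree through vanishing coefficients makes \<open>r = 0\<close> leave only
  the zero sequence. The zero entries from \<open>\<nu>\<close> on give meaning to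
  \<open>W (Suc j)\<close> at the last index.\<close>

definition poly_seqs :: "nat \<Rightarrow> nat \<Rightarrow> (nat \<Rightarrow> complex poly) set" where
  "poly_seqs \<nu> r = {W. (\<forall>j\<ge>\<nu>. W j = 0) \<and> (\<forall>j. \<forall>m\<ge>r. coeff (W j) m = 0)}"

text \<open>The binomial is (i + j)! / (i! j!): the block factor of N(z) times the factorial that
  relates a derivative to a Taylor coefficient.\<close>

definition row_form :: "complex \<Rightarrow> nat \<Rightarrow> nat \<Rightarrow> complex poly \<Rightarrow> (nat \<Rightarrow> complex poly) \<Rightarrow> complex" where
  "row_form z \<nu> i p W = (\<Sum>j<\<nu>. of_nat ((i + j) choose i) * taylor_coeff z (i + j) (p * W j))"

definition seq_diff :: "complex \<Rightarrow> nat \<Rightarrow> (nat \<Rightarrow> complex poly) \<Rightarrow> nat \<Rightarrow> complex poly" where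
  "seq_diff z \<nu> W = (\<lambda>j. if j < \<nu> then [:- z, 1:] * W j - W (Suc j) else 0)"

lemma row_form_diff:
  "row_form z \<nu> i p (\<lambda>j. V j - W j) = row_form z \<nu> i p V - row_form z \<nu> i p W"
  by (simp add: row_form_def taylor_coeff_linear algebra_simps sum_subtractf)

lemma row_form_sum_left:
  "row_form z \<nu> i (\<Sum>a\<in>S. Polynomial.smult (c a) (f a)) W = (\<Sum>a\<in>S. c a * row_form z \<nu> i (f a) W)"
proof -
  have "row_form z \<nu> i (\<Sum>a\<in>S. Polynomial.smult (c a) (f a)) W
     = (\<Sum>j<\<nu>. \<Sum>a\<in>S. c a * (of_nat ((i + j) choose i) * taylor_coeff z (i + j) (f a * W j)))"
    by (simp add: row_form_def sum_distrib_right sum_distrib_left taylor_coeff_sum taylor_coeff_linear ac_simps)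
  also have "\<dots> = (\<Sum>a\<in>S. c a * row_form z \<nu> i (f a) W)"
    by (subst sum.swap) (simp add: row_form_def sum_distrib_left)
  finally show ?thesis .
qed

lemma row_form_seq_diff:
  assumes "W \<nu> = 0"
  shows "row_form z \<nu> 0 p (seq_diff z \<nu> W) = 0"
    and "row_form z \<nu> (Suc i) p (seq_diff z \<nu> W) = row_form z \<nu> i p W"
proof -
  define c where "c j n = taylor_coeff z n (p * W j)" for j n
  have expand: "taylor_coeff z n (p * seq_diff z \<nu> W j) = (case n of 0 \<Rightarrow> 0 | Suc m \<Rightarrow> c j m) - c (Suc j) n"
    if "j < \<nu>" for j n
  proof -
    have "p * seq_diff z \<nu> W j = [:- z, 1:] * (p * W j) - p * W (Suc j)"
      using that unfolding seq_diff_def by (simp only: if_True algebra_simps)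
    then show ?thesis by (simp only: taylor_coeff_linear taylor_coeff_shift c_def)
  qed
  have last: "c \<nu> n = 0" for n
    by (simp add: c_def assms taylor_coeff_linear)
  \<comment> \<open>\<open>?g j\<close> is \<open>c j (j - 1)\<close>, set to 0 at
    \<open>j = 0\<close>; hence \<open>?g (Suc j) = c (Suc j) j\<close> and each summand is a
    consecutive difference.\<close>
  let ?g = "\<lambda>j. case j of 0 \<Rightarrow> 0 | Suc m \<Rightarrow> c j m"
  have "row_form z \<nu> 0 p (seq_diff z \<nu> W) = (\<Sum>j<\<nu>. (case j of 0 \<Rightarrow> 0 | Suc m \<Rightarrow> c j m) - c (Suc j) j)"
    unfolding row_form_def by (rule sum.cong) (simp_all add: expand)
  also have "\<dots> = (\<Sum>j<\<nu>. ?g j - ?g (Suc j))" by simp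
  also have "\<dots> = ?g 0 - ?g \<nu>" by (rule sum_lessThan_telescope')
  also have "\<dots> = 0" by (cases \<nu>) (use last in auto)
  finally show "row_form z \<nu> 0 p (seq_diff z \<nu> W) = 0" .

  have "row_form z \<nu> (Suc i) p (seq_diff z \<nu> W)
      = (\<Sum>j<\<nu>. of_nat ((Suc i + j) choose Suc i) * c j (i + j))
       - (\<Sum>j<\<nu>. of_nat ((i + Suc j) choose Suc i) * c (Suc j) (i + Suc j))"
    unfolding row_form_def sum_subtractf[symmetric]
    by (rule sum.cong) (simp_all add: expand algebra_simps)
  \<comment> \<open>Reindexing adds the term at \<open>j = 0\<close>, which is zero because
    \<open>i choose Suc i\<close> is; the term at \<open>\<nu>\<close> then drops out by
    \<open>last\<close>.\<close>
  also have "(\<Sum>j<\<nu>. of_nat ((i + Suc j) choose Suc i) * c (Suc j) (i + Suc j))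
      = (\<Sum>j<Suc \<nu>. of_nat ((i + j) choose Suc i) * c j (i + j))"
    by (subst sum.lessThan_Suc_shift) simp
  also have "\<dots> = (\<Sum>j<\<nu>. of_nat ((i + j) choose Suc i) * c j (i + j))"
    by (simp add: last)
  \<comment> \<open>Both sums now carry the same \<open>c j (i + j)\<close>, and Pascal's rule
    subtracts the binomials.\<close>
  also have "(\<Sum>j<\<nu>. of_nat ((Suc i + j) choose Suc i) * c j (i + j)) - \<dots>
      = (\<Sum>j<\<nu>. of_nat ((i + j) choose i) * c j (i + j))"
    unfolding sum_subtractf[symmetric] by (rule sum.cong) (simp_all add: algebra_simps)
  finally show "row_form z \<nu> (Suc i) p (seq_diff z \<nu> W) = row_form z \<nu> i p W"
    by (simp add: row_form_def c_def)
qed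

lemma seq_diff_add: "seq_diff z \<nu> (\<lambda>j. V j + W j) = (\<lambda>j. seq_diff z \<nu> V j + seq_diff z \<nu> W j)"
  unfolding seq_diff_def by (rule ext) (simp only: distrib_left, simp)

lemma seq_diff_poly_seqs:
  assumes "W \<in> poly_seqs \<nu> r"
  shows "seq_diff z \<nu> W \<in> poly_seqs \<nu> (Suc r)"
  using assms by (auto simp: poly_seqs_def seq_diff_def coeff_pCons split: nat.split)

text \<open>Multiplication by x - z raises the degree of a nonzero polynomial by exactly one, so
  dividing by it lowers the degree bound by one.\<close>

lemma linear_factor_coeff_vanish:
  fixes U :: "complex poly"
  assumes "\<forall>m\<ge>Suc r. coeff ([:- z, 1:] * U) m = 0" "r \<le> m"
  shows "coeff U m = 0"
proof (cases "U = 0")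
  case False
  then have "degree ([:- z, 1:] * U) = Suc (degree U)"
    by (subst degree_mult_eq) auto
  moreover have "[:- z, 1:] * U \<noteq> 0" using False by (simp del: mult_pCons_left)
  ultimately have "Suc (degree U) < Suc r"
    using assms(1) by (metis leading_coeff_0_iff not_less)
  then show ?thesis using assms(2) by (simp add: coeff_eq_0)
qed simp

text \<open>Induction on the number \<open>n\<close> of possibly nonzero entries: testing with \<open>p = (x - z)^n\<close> (of degree
  below \<open>q\<close>) shows that the last entry vanishes at \<open>z\<close>, so it can be divided by \<open>x - z\<close>.\<close>
lemma row_form_0_kernel_subset:
  assumes "n \<le> \<nu>" "\<nu> \<le> q" "W \<in> poly_seqs n (Suc r)"
    and "\<And>p. degree p < q \<Longrightarrow> row_form z \<nu> 0 p W = 0"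
  shows "\<exists>V \<in> poly_seqs n r. W = seq_diff z \<nu> V"
  using assms
proof (induction n arbitrary: W)
  case 0
  then show ?case by (intro bexI[of _ "\<lambda>_. 0"]) (auto simp: poly_seqs_def seq_diff_def)
next
  case (Suc n)
  have supp: "W j = 0" if "j > n" for j
    using Suc.prems(3) that by (simp add: poly_seqs_def)
  \<comment> \<open>Only \<open>j = n\<close> survives: for smaller \<open>j\<close> the order
    \<open>j\<close> is below the vanishing order \<open>n\<close> at \<open>z\<close>, and for
    larger \<open>j\<close> the entry is zero.\<close>
  have "row_form z \<nu> 0 ([:- z, 1:] ^ n) W = (\<Sum>j<\<nu>. if j = n then poly (W n) z else 0)"
    unfolding row_form_def
    by (rule sum.cong) (auto simp: taylor_coeff_shift_power taylor_coeff_0 supp taylor_coeff_linear)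
  also have "\<dots> = poly (W n) z" using Suc.prems(1) by simp
  finally have "poly (W n) z = 0"
    using Suc.prems(1,2) Suc.prems(4)[of "[:- z, 1:] ^ n"] by (simp add: degree_power_eq)
  then obtain U where U: "W n = [:- z, 1:] * U"
    unfolding poly_eq_0_iff_dvd by (rule dvdE)
  \<comment> \<open>D \<open>V1\<close> equals \<open>W\<close> at index \<open>n\<close> and
    affects otherwise at most index \<open>n - 1\<close>, so subtracting it shortens the
    support.\<close>
  define V1 where "V1 j = (if j = n then U else 0)" for j
  have Uc: "coeff U m = 0" if "m \<ge> r" for m
    by (rule linear_factor_coeff_vanish[of r z]) (use Suc.prems(3) that U[symmetric] in \<open>simp_all add: poly_seqs_def\<close>)
  then have V1: "V1 \<in> poly_seqs (Suc n) r"
    by (auto simp: V1_def poly_seqs_def)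
  have V1': "V1 \<in> poly_seqs \<nu> r" using V1 Suc.prems(1) by (auto simp: poly_seqs_def)
  let ?W' = "\<lambda>j. W j - seq_diff z \<nu> V1 j"
  have "?W' \<in> poly_seqs n (Suc r)"
  proof -
    have "?W' j = 0" if "j \<ge> n" for j
      using that Suc.prems(1) U supp by (cases "j = n") (auto simp: seq_diff_def V1_def simp del: mult_pCons_left)
    moreover have "coeff (?W' j) m = 0" if "m \<ge> Suc r" for j m
      using Suc.prems(3) seq_diff_poly_seqs[OF V1', of z] that by (simp add: poly_seqs_def)
    ultimately show ?thesis by (auto simp: poly_seqs_def)
  qed
  \<comment> \<open>The forms vanish on the range of D, so the subtraction preserves the
    hypothesis.\<close>
  moreover have "row_form z \<nu> 0 p ?W' = 0" if "degree p < q" for p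
    using that Suc.prems(1,4) row_form_seq_diff(1)[of V1 \<nu>] V1' by (simp add: row_form_diff poly_seqs_def)
  ultimately obtain V2 where V2: "V2 \<in> poly_seqs n r" "?W' = seq_diff z \<nu> V2"
    using Suc.IH[of ?W'] Suc.prems(1,2) by auto
  show ?case
  proof (intro bexI)
    show "W = seq_diff z \<nu> (\<lambda>j. V1 j + V2 j)"
      unfolding seq_diff_add V2(2)[symmetric] by auto
    show "(\<lambda>j. V1 j + V2 j) \<in> poly_seqs (Suc n) r"
      using V1 V2(1) by (auto simp: poly_seqs_def)
  qed
qed

section \<open>Injectivity and powers of D\<close>

lemma seq_diff_funpow_0: "(seq_diff z \<nu> ^^ n) (\<lambda>_. 0) = (\<lambda>_. 0)"
  by (induction n) (simp_all add: seq_diff_def cong: if_cong)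

text \<open>Work backwards from index \<open>\<nu>\<close>: once the next entry is zero, D reduces
  to multiplication by x - z, which has no zero divisors.\<close>

lemma seq_diff_inj:
  assumes "\<forall>j\<ge>\<nu>. W j = 0" "seq_diff z \<nu> W = (\<lambda>_. 0)"
  shows "W = (\<lambda>_. 0)"
proof
  fix j
  have "W (\<nu> - k) = 0" for k
  proof (induction k)
    case (Suc k)
    show ?case
    proof (cases "k < \<nu>")
      case True
      then have "seq_diff z \<nu> W (\<nu> - Suc k) = [:- z, 1:] * W (\<nu> - Suc k)"
        using Suc by (simp add: seq_diff_def Suc_diff_Suc del: mult_pCons_left)
      then show ?thesis using assms(2) by (simp del: mult_pCons_left)
    qed (use Suc in simp)
  qed (use assms in simp)
  from this[of "\<nu> - j"] assms(1) show "W j = 0"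
    by (cases "j < \<nu>") auto
qed

lemma seq_diff_funpow_poly_seqs:
  "V \<in> poly_seqs \<nu> r \<Longrightarrow> (seq_diff z \<nu> ^^ n) V \<in> poly_seqs \<nu> (r + n)"
  by (induction n) (auto intro: seq_diff_poly_seqs)

lemma seq_diff_funpow_inj:
  assumes "V \<in> poly_seqs \<nu> r" "(seq_diff z \<nu> ^^ n) V = (\<lambda>_. 0)"
  shows "V = (\<lambda>_. 0)"
  using assms(2)
proof (induction n)
  case (Suc n)
  have "(seq_diff z \<nu> ^^ n) V = (\<lambda>_. 0)"
    by (rule seq_diff_inj[of \<nu> _ z])
      (use Suc.prems seq_diff_funpow_poly_seqs[OF assms(1), where z = z and n = n]
        in \<open>simp_all add: poly_seqs_def\<close>)
  then show ?case by (rule Suc.IH)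
qed simp

text \<open>The forms of index 0 give W = D U with a degree bound smaller by one, and the remaining
  forms on W are those on U with the index lowered. Hence \<open>r\<close> and \<open>W\<close> vary
  in the induction.\<close>

lemma row_forms_kernel:
  assumes "\<nu> \<le> q" "W \<in> poly_seqs \<nu> r"
  shows "(\<forall>i<\<mu>. \<forall>p. degree p < q \<longrightarrow> row_form z \<nu> i p W = 0)
     \<longleftrightarrow> (\<exists>V \<in> poly_seqs \<nu> (r - \<mu>). W = (seq_diff z \<nu> ^^ \<mu>) V)"
  using assms(2)
proof (induction \<mu> arbitrary: r W)
  case 0
  then show ?case by auto
next
  case (Suc \<mu>)
  show ?case
  proof
    assume *: "\<forall>i<Suc \<mu>. \<forall>p. degree p < q \<longrightarrow> row_form z \<nu> i p W = 0"
    \<comment> \<open>For \<open>r = 0\<close> the subtraction truncates, but then W is zero and so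
      is a preimage.\<close>
    have "\<exists>U \<in> poly_seqs \<nu> (r - 1). W = seq_diff z \<nu> U"
    proof (cases r)
      case 0
      then have "W = (\<lambda>_. 0)" using Suc.prems by (auto simp: poly_seqs_def poly_eq_iff)
      then show ?thesis using seq_diff_funpow_0[where n = 1]
        by (intro bexI[of _ "\<lambda>_. 0"]) (auto simp: poly_seqs_def)
    next
      case (Suc r')
      then show ?thesis
        using row_form_0_kernel_subset[where n = \<nu> and \<nu> = \<nu> and q = q and W = W and r = r' and z = z]
          assms(1) Suc.prems * by auto
    qed
    then obtain U where U: "U \<in> poly_seqs \<nu> (r - 1)" "W = seq_diff z \<nu> U" by blast
    have "\<forall>i<\<mu>. \<forall>p. degree p < q \<longrightarrow> row_form z \<nu> i p U = 0"
      using * row_form_seq_diff(2)[where W = U and \<nu> = \<nu> and z = z] U by (auto simp: poly_seqs_def)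
    then obtain V where "V \<in> poly_seqs \<nu> (r - 1 - \<mu>)" "U = (seq_diff z \<nu> ^^ \<mu>) V"
      using Suc.IH[OF U(1)] by blast
    then show "\<exists>V \<in> poly_seqs \<nu> (r - Suc \<mu>). W = (seq_diff z \<nu> ^^ Suc \<mu>) V"
      using U(2) by auto
  next
    assume "\<exists>V \<in> poly_seqs \<nu> (r - Suc \<mu>). W = (seq_diff z \<nu> ^^ Suc \<mu>) V"
    then obtain V where V: "V \<in> poly_seqs \<nu> (r - Suc \<mu>)" "W = seq_diff z \<nu> ((seq_diff z \<nu> ^^ \<mu>) V)"
      by auto
    let ?U = "(seq_diff z \<nu> ^^ \<mu>) V"
    \<comment> \<open>This bound, rather than \<open>r - 1\<close>, also fits truncated subtraction:
      taking away \<open>\<mu>\<close> returns \<open>r - Suc \<mu>\<close> exactly.\<close>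
    have U: "?U \<in> poly_seqs \<nu> (r - Suc \<mu> + \<mu>)"
      by (rule seq_diff_funpow_poly_seqs[OF V(1)])
    have "\<forall>i<\<mu>. \<forall>p. degree p < q \<longrightarrow> row_form z \<nu> i p ?U = 0"
      using Suc.IH[OF U] V(1) by auto
    then show "\<forall>i<Suc \<mu>. \<forall>p. degree p < q \<longrightarrow> row_form z \<nu> i p W = 0"
      using row_form_seq_diff[where W = ?U and \<nu> = \<nu> and z = z] U unfolding V(2)
      by (auto simp: poly_seqs_def less_Suc_eq_0_disj)
  qed
qed

section \<open>Block vectors as polynomial sequences\<close>

lemma block_index_less: "j < n \<Longrightarrow> b < k \<Longrightarrow> j * k + b < n * (k :: nat)"
  using mult_le_mono1[of "Suc j" n k] by simp

lemma sum_blocks: "(\<Sum>J<n * k. g J) = (\<Sum>j<n. \<Sum>b<k. g (j * k + b))" for k :: nat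
proof -
  have "sum g {m..<m + k} = (\<Sum>b<k. g (m + b))" for m
    using sum.shift_bounds_nat_ivl[of g 0 m k] by (simp add: add.commute lessThan_atLeast0)
  then show ?thesis by (simp flip: sum.nat_group)
qed

lemma mult_mat_vec_blocks:
  assumes "A \<in> carrier_mat n (\<nu> * k)" "v \<in> carrier_vec (\<nu> * k)" "I < n"
  shows "(A *\<^sub>v v) $ I = (\<Sum>j<\<nu>. \<Sum>b<k. A $$ (I, j * k + b) * v $ (j * k + b))"
proof -
  have "(A *\<^sub>v v) $ I = (\<Sum>J<\<nu> * k. A $$ (I, J) * v $ J)"
    using assms by (simp add: scalar_prod_def lessThan_atLeast0)
  then show ?thesis by (simp only: sum_blocks)
qed

text \<open>Block \<open>j\<close> of the vector lists the coefficients of polynomial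
  \<open>j\<close>. The next lemmas make this a bijection from vectors of length
  \<open>\<nu> * r\<close> onto \<open>poly_seqs \<nu> r\<close>.\<close>

definition block_polys :: "nat \<Rightarrow> nat \<Rightarrow> complex vec \<Rightarrow> nat \<Rightarrow> complex poly" where
  "block_polys \<nu> r v j = (if j < \<nu> then \<Sum>b<r. monom (v $ (j * r + b)) b else 0)"

lemma coeff_block_polys:
  "coeff (block_polys \<nu> r v j) m = (if j < \<nu> \<and> m < r then v $ (j * r + m) else 0)"
  by (simp add: block_polys_def coeff_sum)

lemma block_polys_in_poly_seqs: "block_polys \<nu> r v \<in> poly_seqs \<nu> r"
  by (auto simp: poly_seqs_def coeff_block_polys poly_eq_iff)

lemma block_polys_inj:
  assumes "v \<in> carrier_vec (\<nu> * r)" "w \<in> carrier_vec (\<nu> * r)"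
    and eq: "block_polys \<nu> r v = block_polys \<nu> r w"
  shows "v = w"
proof (rule eq_vecI)
  fix J assume "J < dim_vec w"
  then have J: "J < \<nu> * r" using assms(2) by simp
  then have "0 < r" by (cases r) auto
  with J have "J div r < \<nu>" "J mod r < r" by (auto simp: less_mult_imp_div_less)
  then show "v $ J = w $ J"
    using arg_cong[OF eq, of "\<lambda>W. coeff (W (J div r)) (J mod r)"] by (simp add: coeff_block_polys)
qed (use assms in auto)

lemma block_polys_surj:
  assumes "V \<in> poly_seqs \<nu> r"
  obtains w where "w \<in> carrier_vec (\<nu> * r)" "block_polys \<nu> r w = V"
proof
  define w where "w = vec (\<nu> * r) (\<lambda>J. coeff (V (J div r)) (J mod r))"
  show "w \<in> carrier_vec (\<nu> * r)" by (simp add: w_def)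
  show "block_polys \<nu> r w = V"
  proof (intro ext poly_eqI)
    fix j m
    show "coeff (block_polys \<nu> r w j) m = coeff (V j) m"
      using assms by (auto simp: coeff_block_polys w_def block_index_less poly_seqs_def not_less)
  qed
qed

lemma block_polys_zero: "block_polys \<nu> r (0\<^sub>v (\<nu> * r)) = (\<lambda>_. 0)"
  by (intro ext poly_eqI) (simp add: coeff_block_polys block_index_less)

lemma block_polys_no_coeffs: "block_polys \<nu> 0 v = (\<lambda>_. 0)"
  by (intro ext) (simp add: block_polys_def)

section \<open>The rows of N(z) as row forms\<close>

lemma Nmat_carrier: "Nmat q r \<mu> \<nu> z \<in> carrier_mat (\<mu> * q) (\<nu> * r)"
  by (simp add: Nmat_def)

lemma Nmat_index:
  assumes "i < \<mu>" "a < q" "j < \<nu>" "b < r"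
  shows "Nmat q r \<mu> \<nu> z $$ (i * q + a, j * r + b)
     = of_nat ((i + j) choose i) * taylor_coeff z (i + j) (monom 1 (a + b))"
proof -
  have "mat_deriv_n n (\<lambda>w. u_vec q w * w_vec r w) z $$ (a, b) = (deriv ^^ n) (poly (monom 1 (a + b))) z" for n
  proof -
    \<comment> \<open>An entry of the rank-one product u(w) w(w) is a single power of w.\<close>
    have "(\<lambda>w. (u_vec q w * w_vec r w) $$ (a, b)) = poly (monom 1 (a + b) :: complex poly)"
      using assms by (auto simp: fun_eq_iff u_vec_def w_vec_def scalar_prod_def poly_monom power_add)
    then show ?thesis using assms by (simp add: mat_deriv_n_def u_vec_def w_vec_def)
  qed
  moreover have "of_nat ((i + j) choose i) = (fact (i + j) / (fact i * fact j) :: complex)"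
    by (subst binomial_fact) auto
  ultimately show ?thesis
    using assms by (simp add: Nmat_def block_index_less higher_deriv_poly_eq_taylor_coeff)
qed

lemma Nmat_mult_vec_index:
  assumes "i < \<mu>" "a < q" "v \<in> carrier_vec (\<nu> * r)"
  shows "(Nmat q r \<mu> \<nu> z *\<^sub>v v) $ (i * q + a) = row_form z \<nu> i (monom 1 a) (block_polys \<nu> r v)"
proof -
  have "(\<Sum>b<r. Nmat q r \<mu> \<nu> z $$ (i * q + a, j * r + b) * v $ (j * r + b))
      = of_nat ((i + j) choose i) * taylor_coeff z (i + j) (monom 1 a * block_polys \<nu> r v j)"
    if "j < \<nu>" for j
  proof -
    have "monom 1 a * block_polys \<nu> r v j
        = (\<Sum>b<r. Polynomial.smult (v $ (j * r + b)) (monom 1 (a + b)))"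
      using that by (simp add: block_polys_def sum_distrib_left mult_monom smult_monom)
    then show ?thesis
      using that assms
      by (simp add: Nmat_index taylor_coeff_sum taylor_coeff_linear sum_distrib_left mult_ac)
  qed
  then show ?thesis
    using assms
    by (subst mult_mat_vec_blocks[OF Nmat_carrier]) (simp_all add: block_index_less row_form_def)
qed

text \<open>Row \<open>a\<close> of a block row tests with the monomial of degree \<open>a\<close>.
  Linearity in \<open>p\<close> extends this to all degrees below \<open>q\<close>, which admits
  powers of x - z as tests.\<close>

lemma mat_kernel_Nmat_iff:
  assumes v: "v \<in> carrier_vec (\<nu> * r)"
  shows "v \<in> mat_kernel (Nmat q r \<mu> \<nu> z) \<longleftrightarrow>
    (\<forall>i<\<mu>. \<forall>p. degree p < q \<longrightarrow> row_form z \<nu> i p (block_polys \<nu> r v) = 0)"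
proof -
  let ?f = "\<lambda>i p. row_form z \<nu> i p (block_polys \<nu> r v)"
  have "v \<in> mat_kernel (Nmat q r \<mu> \<nu> z) \<longleftrightarrow> (\<forall>I<\<mu> * q. (Nmat q r \<mu> \<nu> z *\<^sub>v v) $ I = 0)"
    using v Nmat_carrier[of q r \<mu> \<nu> z] by (auto simp: mat_kernel_def vec_eq_iff simp del: index_mult_mat_vec)
  also have "\<dots> \<longleftrightarrow> (\<forall>i<\<mu>. \<forall>a<q. ?f i (monom 1 a) = 0)"
  proof (intro iffI allI impI)
    fix i a assume "\<forall>I<\<mu> * q. (Nmat q r \<mu> \<nu> z *\<^sub>v v) $ I = 0" "i < \<mu>" "a < q"
    then show "?f i (monom 1 a) = 0"
      using Nmat_mult_vec_index[OF _ _ v, of i \<mu> a q z] by (metis block_index_less)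
  next
    fix I assume *: "\<forall>i<\<mu>. \<forall>a<q. ?f i (monom 1 a) = 0" and I: "I < \<mu> * q"
    then have "0 < q" by (cases q) auto
    with I have "I div q < \<mu>" "I mod q < q" by (auto simp: less_mult_imp_div_less)
    then show "(Nmat q r \<mu> \<nu> z *\<^sub>v v) $ I = 0"
      using * Nmat_mult_vec_index[OF _ _ v, of "I div q" \<mu> "I mod q" q z] by simp
  qed
  also have "\<dots> \<longleftrightarrow> (\<forall>i<\<mu>. \<forall>p. degree p < q \<longrightarrow> ?f i p = 0)"
  proof (intro iffI allI impI)
    fix i and p :: "complex poly"
    assume *: "\<forall>i<\<mu>. \<forall>a<q. ?f i (monom 1 a) = 0" "i < \<mu>" "degree p < q"
    have "p = (\<Sum>a\<le>degree p. Polynomial.smult (coeff p a) (monom 1 a))"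
      by (simp add: smult_monom poly_as_sum_of_monoms)
    then have "?f i p = (\<Sum>a\<le>degree p. coeff p a * ?f i (monom 1 a))"
      by (metis row_form_sum_left)
    then show "?f i p = 0" using * by simp
  next
    fix i a assume "\<forall>i<\<mu>. \<forall>p. degree p < q \<longrightarrow> ?f i p = 0" "i < \<mu>" "a < q"
    then show "?f i (monom 1 a) = 0"
      by (simp add: degree_monom_eq)
  qed
  finally show ?thesis .
qed

section \<open>The matrices K_k(z) and their product as powers of D\<close>

lemma Kmat_carrier: "Kmat r \<nu> k z \<in> carrier_mat (\<nu> * (r - k)) (\<nu> * (r - k - 1))"
  by (auto simp: Kmat_def kron_def Fmat_def shift_mat_def mat_deriv_n_def)

lemma kron_dim [simp]:
  "dim_row (kron A B) = dim_row A * dim_row B" "dim_col (kron A B) = dim_col A * dim_col B"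
  by (simp_all add: kron_def)

lemma shift_mat_dim [simp]: "dim_row (shift_mat n) = n" "dim_col (shift_mat n) = n"
  by (simp_all add: shift_mat_def)

lemma kron_index:
  assumes "j < dim_row A" "a < dim_row B" "l < dim_col A" "b < dim_col B"
  shows "kron A B $$ (j * dim_row B + a, l * dim_col B + b) = A $$ (j, l) * B $$ (a, b)"
  using assms by (simp add: kron_def block_index_less)

lemma Kmat_index:
  assumes "j < \<nu>" "a < r - k" "l < \<nu>" "b < r - k - 1"
  shows "Kmat r \<nu> k z $$ (j * (r - k) + a, l * (r - k - 1) + b)
     = (if l = j then (if b = a then - z else 0) + (if b + 1 = a then 1 else 0) else 0)
       - (if l = Suc j \<and> b = a then 1 else 0)"
proof -
  \<comment> \<open>Only the diagonal of F_k depends on z; its derivative -1 is the source of the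
    minus sign before \<open>W (Suc j)\<close> in D.\<close>
  have "deriv (\<lambda>w. Fmat r k w $$ (a, b)) z = (if a = b then - 1 else 0)"
    using assms by (auto simp: Fmat_def)
  then have "mat_deriv_n 1 (Fmat r k) z $$ (a, b) = (if a = b then - 1 else 0)"
    using assms by (simp add: mat_deriv_n_def Fmat_def)
  moreover have "Fmat r k z $$ (a, b) = (if b = a then - z else 0) + (if b + 1 = a then 1 else 0)"
    using assms by (auto simp: Fmat_def)
  moreover have "dim_row (Fmat r k z) = r - k" "dim_col (Fmat r k z) = r - k - 1"
    "dim_row (mat_deriv_n 1 (Fmat r k) z) = r - k" "dim_col (mat_deriv_n 1 (Fmat r k) z) = r - k - 1"
    by (simp_all add: Fmat_def mat_deriv_n_def)
  moreover have "Kmat r \<nu> k z $$ (j * (r - k) + a, l * (r - k - 1) + b)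
      = 1\<^sub>m \<nu> $$ (j, l) * Fmat r k z $$ (a, b) + shift_mat \<nu> $$ (j, l) * mat_deriv_n 1 (Fmat r k) z $$ (a, b)"
    using assms block_index_less[OF assms(1,2)] block_index_less[OF assms(3,4)]
      kron_index[of j "1\<^sub>m \<nu>" a "Fmat r k z" l b]
      kron_index[of j "shift_mat \<nu>" a "mat_deriv_n 1 (Fmat r k) z" l b] calculation(3-6)
    by (simp add: Kmat_def)
  ultimately show ?thesis
    using assms by (auto simp: shift_mat_def)
qed

text \<open>F_k is the coefficient matrix of multiplication by x - z, its derivative is minus the
  inclusion into the larger degree bound, and the shift matrix selects the next block.\<close>

lemma block_polys_Kmat_mult_vec:
  assumes "k < r" and w: "w \<in> carrier_vec (\<nu> * (r - k - 1))"
  shows "block_polys \<nu> (r - k) (Kmat r \<nu> k z *\<^sub>v w) = seq_diff z \<nu> (block_polys \<nu> (r - k - 1) w)"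
proof (intro ext poly_eqI)
  fix j m
  define R where "R = r - k - 1"
  have R: "r - k = Suc R" "r - k - 1 = R" using assms(1) by (simp_all add: R_def)
  define P where "P = block_polys \<nu> R w"
  have P0: "coeff (P l) b = 0" if "l \<ge> \<nu> \<or> b \<ge> R" for l b
    using that by (auto simp: P_def coeff_block_polys)
  show "coeff (block_polys \<nu> (r - k) (Kmat r \<nu> k z *\<^sub>v w) j) m
      = coeff (seq_diff z \<nu> (block_polys \<nu> (r - k - 1) w) j) m"
  proof (cases "j < \<nu> \<and> m < Suc R")
    case True
    then have "coeff (block_polys \<nu> (r - k) (Kmat r \<nu> k z *\<^sub>v w) j) m
        = (Kmat r \<nu> k z *\<^sub>v w) $ (j * (r - k) + m)"
      by (simp add: coeff_block_polys R)
    also have "\<dots> = (\<Sum>l<\<nu>. \<Sum>b<R.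
        ((if l = j then (if b = m then - z else 0) + (if b + 1 = m then 1 else 0) else 0)
       - (if l = Suc j \<and> b = m then 1 else 0)) * coeff (P l) b)"
      using True Kmat_index[of j \<nu> m r k _ _ z] unfolding R
      by (subst mult_mat_vec_blocks[OF Kmat_carrier[of r \<nu> k z, unfolded R] w[unfolded R]])
        (simp_all add: block_index_less P_def coeff_block_polys del: mult_Suc_right)
    \<comment> \<open>The three sums are the diagonal, the subdiagonal and the shifted
      contribution.\<close>
    also have "\<dots> = (\<Sum>l<\<nu>. (\<Sum>b<R. if l = j \<and> b = m then - z * coeff (P l) b else 0)
        + (\<Sum>b<R. if l = j \<and> b + 1 = m then coeff (P l) b else 0)
        - (\<Sum>b<R. if l = Suc j \<and> b = m then coeff (P l) b else 0))"
      unfolding sum.distrib[symmetric] sum_subtractf[symmetric] by (intro sum.cong refl) auto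
    also have "\<dots> = (\<Sum>l<\<nu>. (if l = j then \<Sum>b<R. if b = m then - z * coeff (P l) b else 0 else 0)
        + (if l = j then \<Sum>b<R. if b + 1 = m then coeff (P l) b else 0 else 0)
        - (if l = Suc j then \<Sum>b<R. if b = m then coeff (P l) b else 0 else 0))"
      by (intro sum.cong refl) simp
    \<comment> \<open>When \<open>m = R\<close> or \<open>Suc j = \<nu>\<close> an index falls
      outside the sums; by \<open>P0\<close> the corresponding coefficient is zero.\<close>
    also have "\<dots> = - z * coeff (P j) m + (\<Sum>b<R. if b + 1 = m then coeff (P j) b else 0) - coeff (P (Suc j)) m"
      using True by (simp add: sum_subtractf sum.distrib P0)
    also have "(\<Sum>b<R. if b + 1 = m then coeff (P j) b else 0) = (case m of 0 \<Rightarrow> 0 | Suc m' \<Rightarrow> coeff (P j) m')"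
      using True by (auto split: nat.split)
    also have "- z * coeff (P j) m + \<dots> - coeff (P (Suc j)) m = coeff (seq_diff z \<nu> P j) m"
      using True by (simp add: seq_diff_def coeff_pCons split: nat.split)
    finally show ?thesis by (simp add: P_def R)
  next
    case False
    have "seq_diff z \<nu> P \<in> poly_seqs \<nu> (Suc R)"
      unfolding P_def by (intro seq_diff_poly_seqs block_polys_in_poly_seqs)
    with False show ?thesis by (auto simp: P_def R coeff_block_polys poly_seqs_def not_less)
  qed
qed

text \<open>A product starting at an arbitrary \<open>k\<close> lets the induction peel off the
  leftmost factor.\<close>

lemma block_polys_Kmat_product_mult_vec:
  fixes k n r \<nu> :: nat and z :: complex
  assumes "k + n \<le> r"
  defines "A \<equiv> foldr (\<lambda>k acc. Kmat r \<nu> k z * acc) [k..<k + n] (1\<^sub>m (\<nu> * (r - (k + n))))"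
  shows "A \<in> carrier_mat (\<nu> * (r - k)) (\<nu> * (r - (k + n)))"
    and "w \<in> carrier_vec (\<nu> * (r - (k + n))) \<Longrightarrow>
      block_polys \<nu> (r - k) (A *\<^sub>v w) = (seq_diff z \<nu> ^^ n) (block_polys \<nu> (r - (k + n)) w)"
proof -
  have "A \<in> carrier_mat (\<nu> * (r - k)) (\<nu> * (r - (k + n))) \<and>
    (w \<in> carrier_vec (\<nu> * (r - (k + n))) \<longrightarrow>
      block_polys \<nu> (r - k) (A *\<^sub>v w) = (seq_diff z \<nu> ^^ n) (block_polys \<nu> (r - (k + n)) w))"
    using assms(1) unfolding A_def
  proof (induction n arbitrary: k)
    case 0
    then show ?case by simp
  next
    case (Suc n)
    let ?B = "foldr (\<lambda>k acc. Kmat r \<nu> k z * acc) [Suc k..<Suc k + n] (1\<^sub>m (\<nu> * (r - (Suc k + n))))"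
    have IH: "?B \<in> carrier_mat (\<nu> * (r - Suc k)) (\<nu> * (r - (Suc k + n)))"
      "w \<in> carrier_vec (\<nu> * (r - (Suc k + n))) \<Longrightarrow>
        block_polys \<nu> (r - Suc k) (?B *\<^sub>v w) = (seq_diff z \<nu> ^^ n) (block_polys \<nu> (r - (Suc k + n)) w)"
      using Suc.IH[of "Suc k"] Suc.prems by auto
    have list: "[k..<k + Suc n] = k # [Suc k..<Suc k + n]" "k + Suc n = Suc k + n"
      by (simp_all add: upt_conv_Cons)
    have K: "Kmat r \<nu> k z \<in> carrier_mat (\<nu> * (r - k)) (\<nu> * (r - Suc k))"
      using Kmat_carrier[of r \<nu> k z] by simp
    show ?case
    proof (intro conjI impI)
      show "foldr (\<lambda>k acc. Kmat r \<nu> k z * acc) [k..<k + Suc n] (1\<^sub>m (\<nu> * (r - (k + Suc n))))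
          \<in> carrier_mat (\<nu> * (r - k)) (\<nu> * (r - (k + Suc n)))"
        unfolding list(1) unfolding list(2) using mult_carrier_mat[OF K IH(1)] by (simp del: upt_Suc)
      assume w: "w \<in> carrier_vec (\<nu> * (r - (k + Suc n)))"
      then have w': "w \<in> carrier_vec (\<nu> * (r - (Suc k + n)))" by simp
      have "block_polys \<nu> (r - k) (Kmat r \<nu> k z *\<^sub>v (?B *\<^sub>v w))
          = seq_diff z \<nu> (block_polys \<nu> (r - Suc k) (?B *\<^sub>v w))"
        using block_polys_Kmat_mult_vec[of k r "?B *\<^sub>v w" \<nu> z] Suc.prems
          mult_mat_vec_carrier[OF IH(1) w'] by simp
      then show "block_polys \<nu> (r - k)
          (foldr (\<lambda>k acc. Kmat r \<nu> k z * acc) [k..<k + Suc n] (1\<^sub>m (\<nu> * (r - (k + Suc n)))) *\<^sub>v w)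
        = (seq_diff z \<nu> ^^ Suc n) (block_polys \<nu> (r - (k + Suc n)) w)"
        unfolding list(1) unfolding list(2) using assoc_mult_mat_vec[OF K IH(1) w'] IH(2)[OF w'] by (simp del: upt_Suc)
    qed
  qed
  then show "A \<in> carrier_mat (\<nu> * (r - k)) (\<nu> * (r - (k + n)))"
    and "w \<in> carrier_vec (\<nu> * (r - (k + n))) \<Longrightarrow>
      block_polys \<nu> (r - k) (A *\<^sub>v w) = (seq_diff z \<nu> ^^ n) (block_polys \<nu> (r - (k + n)) w)"
    by auto
qed

lemma Kcal_carrier: "Kcal r \<mu> \<nu> z \<in> carrier_mat (\<nu> * r) (\<nu> * (r - \<mu>))"
  using block_polys_Kmat_product_mult_vec(1)[of 0 \<mu> r \<nu> z] by (simp add: Kcal_def)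

lemma block_polys_Kcal_mult_vec:
  assumes "w \<in> carrier_vec (\<nu> * (r - \<mu>))"
  shows "block_polys \<nu> r (Kcal r \<mu> \<nu> z *\<^sub>v w) = (seq_diff z \<nu> ^^ \<mu>) (block_polys \<nu> (r - \<mu>) w)"
proof (cases "\<mu> < r")
  case True
  then show ?thesis
    using block_polys_Kmat_product_mult_vec(2)[of 0 \<mu> r w \<nu> z] assms by (simp add: Kcal_def)
next
  case False
  \<comment> \<open>Here \<open>r - \<mu> = 0\<close>, so the polynomial sequence of
    \<open>w\<close> is zero as well and both sides vanish.\<close>
  then have "Kcal r \<mu> \<nu> z *\<^sub>v w = 0\<^sub>v (\<nu> * r)"
    using assms by (intro eq_vecI) (auto simp: Kcal_def scalar_prod_def)
  then show ?thesis
    using False by (simp add: block_polys_zero block_polys_no_coeffs seq_diff_funpow_0)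
qed

text \<open>Injectivity of D carries over to the product; its columns are thus independent and their
  number is its rank.\<close>

lemma mat_kernel_Kcal: "mat_kernel (Kcal r \<mu> \<nu> z) = {0\<^sub>v (\<nu> * (r - \<mu>))}"
proof -
  have "w = 0\<^sub>v (\<nu> * (r - \<mu>))"
    if w: "w \<in> carrier_vec (\<nu> * (r - \<mu>))" and 0: "Kcal r \<mu> \<nu> z *\<^sub>v w = 0\<^sub>v (\<nu> * r)" for w
  proof (rule block_polys_inj[OF w])
    have "(seq_diff z \<nu> ^^ \<mu>) (block_polys \<nu> (r - \<mu>) w) = (\<lambda>_. 0)"
      using block_polys_Kcal_mult_vec[OF w, of z] by (simp add: 0 block_polys_zero)
    then show "block_polys \<nu> (r - \<mu>) w = block_polys \<nu> (r - \<mu>) (0\<^sub>v (\<nu> * (r - \<mu>)))"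
      using seq_diff_funpow_inj[OF block_polys_in_poly_seqs] by (simp add: block_polys_zero)
  qed simp
  then show ?thesis
    using Kcal_carrier[of r \<mu> \<nu> z] by (auto simp: mat_kernel_def)
qed

section \<open>Kernel, nullity and rank of N(z)\<close>

lemma mat_kernel_Nmat:
  assumes "\<nu> \<le> q"
  shows "mat_kernel (Nmat q r \<mu> \<nu> z) = span_vecs (\<nu> * r) (set (cols (Kcal r \<mu> \<nu> z)))"
proof -
  have mult_carrier: "Kcal r \<mu> \<nu> z *\<^sub>v w \<in> carrier_vec (\<nu> * r)" if "w \<in> carrier_vec (\<nu> * (r - \<mu>))" for w
    using Kcal_carrier that by (rule mult_mat_vec_carrier)
  have "v \<in> mat_kernel (Nmat q r \<mu> \<nu> z) \<longleftrightarrow> v \<in> (\<lambda>w. Kcal r \<mu> \<nu> z *\<^sub>v w) ` carrier_vec (\<nu> * (r - \<mu>))"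
    if v: "v \<in> carrier_vec (\<nu> * r)" for v
  proof -
    have "v \<in> mat_kernel (Nmat q r \<mu> \<nu> z)
        \<longleftrightarrow> (\<exists>V \<in> poly_seqs \<nu> (r - \<mu>). block_polys \<nu> r v = (seq_diff z \<nu> ^^ \<mu>) V)"
      unfolding mat_kernel_Nmat_iff[OF v] by (rule row_forms_kernel[OF assms block_polys_in_poly_seqs])
    also have "\<dots> \<longleftrightarrow> (\<exists>w \<in> carrier_vec (\<nu> * (r - \<mu>)).
        block_polys \<nu> r v = (seq_diff z \<nu> ^^ \<mu>) (block_polys \<nu> (r - \<mu>) w))"
    proof
      assume "\<exists>V \<in> poly_seqs \<nu> (r - \<mu>). block_polys \<nu> r v = (seq_diff z \<nu> ^^ \<mu>) V"
      then obtain V where "V \<in> poly_seqs \<nu> (r - \<mu>)" "block_polys \<nu> r v = (seq_diff z \<nu> ^^ \<mu>) V" ..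
      then show "\<exists>w \<in> carrier_vec (\<nu> * (r - \<mu>)).
          block_polys \<nu> r v = (seq_diff z \<nu> ^^ \<mu>) (block_polys \<nu> (r - \<mu>) w)"
        using block_polys_surj[of V \<nu> "r - \<mu>"] by blast
    qed (use block_polys_in_poly_seqs in blast)
    \<comment> \<open>The power of D is the polynomial sequence of the product vector, and vectors
      are determined by their sequences.\<close>
    also have "\<dots> \<longleftrightarrow> (\<exists>w \<in> carrier_vec (\<nu> * (r - \<mu>)). v = Kcal r \<mu> \<nu> z *\<^sub>v w)"
    proof (rule bex_cong[OF refl])
      fix w :: "complex vec" assume w: "w \<in> carrier_vec (\<nu> * (r - \<mu>))"
      show "block_polys \<nu> r v = (seq_diff z \<nu> ^^ \<mu>) (block_polys \<nu> (r - \<mu>) w)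
          \<longleftrightarrow> v = Kcal r \<mu> \<nu> z *\<^sub>v w"
        unfolding block_polys_Kcal_mult_vec[OF w, symmetric]
        using block_polys_inj[OF v mult_carrier[OF w]] by blast
    qed
    finally show ?thesis by auto
  qed
  then show ?thesis
    unfolding span_cols_eq_image[OF Kcal_carrier]
    using mat_kernel_carrier[OF Nmat_carrier] mult_carrier by blast
qed

theorem theorem5p2:
  fixes q r \<mu> \<nu> :: nat and z :: complex
  assumes "0 < q" "0 < r" "0 < \<mu>" "0 < \<nu>" "\<nu> \<le> q"
  shows "mat_kernel (Nmat q r \<mu> \<nu> z) = span_vecs (\<nu> * r) (set (cols (Kcal r \<mu> \<nu> z)))
       \<and> kernel_dim (Nmat q r \<mu> \<nu> z) = \<nu> * (r - \<mu>)
       \<and> vec_space.rank (\<mu> * q) (Nmat q r \<mu> \<nu> z) = \<nu> * min \<mu> r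
       \<and> (vec_space.rank (\<mu> * q) (Nmat q r \<mu> \<nu> z) = \<nu> * r \<longleftrightarrow> \<mu> \<ge> r)"
proof -
  note ker = mat_kernel_Nmat[OF assms(5), of r \<mu> z]
  have dim: "kernel_dim (Nmat q r \<mu> \<nu> z) = \<nu> * (r - \<mu>)"
    using kernel_dim_eq_rank[OF Nmat_carrier ker] rank_eq_dim_col[OF Kcal_carrier mat_kernel_Kcal]
    by simp
  have "min \<mu> r + (r - \<mu>) = r" by simp
  then have "\<nu> * min \<mu> r + \<nu> * (r - \<mu>) = \<nu> * r"
    by (metis add_mult_distrib2)
  then have rank: "vec_space.rank (\<mu> * q) (Nmat q r \<mu> \<nu> z) = \<nu> * min \<mu> r"
    using rank_plus_kernel_dim[OF Nmat_carrier[of q r \<mu> \<nu> z]] dim by simp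
  \<comment> \<open>Cancelling the positive \<open>\<nu>\<close> leaves
    \<open>min \<mu> r = r\<close>.\<close>
  moreover have "\<nu> * min \<mu> r = \<nu> * r \<longleftrightarrow> \<mu> \<ge> r"
    using assms(4) by auto
  ultimately show ?thesis using ker dim by simp
qed

end
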